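(* Let $G$ be a group, regarded as a trivial skew brace, and let $K$ be an abelian group. Then $$H^2_b(G,K)\simeq H^2(G,K)\times\mathrm{Hom}(G,\mathrm{Hom}(G,K)),$$ where $H^2(G,K)$ is the second group cohomology of $G$ with coefficients in the trivial module $K$.
   Context: A skew brace is a triple $(A,+,\circ)$ where $(A,+)$ and $(A,\circ)$ are (not necessarily abelian) groups with $a\circ(b+c)=a\circ b-a+a\circ c$ for all $a,b,c\in A$. Both groups have the same neutral element $0$. A group $G$ is regarded as a trivial skew brace via $x+y=xy$ and $x\circ y=xy$. For a skew brace $Q$ and a (multiplicative) abelian group $K$, a factor set is a pair $(\alpha,\mu)$ of maps $Q\times Q\to K$ such that for all $x,y,z\in Q$: $\alpha(0,y)=\alpha(x,0)=1$, $\mu(0,y)=\mu(x,0)=1$, $\alpha(y,z)\alpha(x+y,z)^{-1}\alpha(x,y+z)\alpha(x,y)^{-1}=1$, $\mu(y,z)\mu(x\circ y,z)^{-1}\mu(x,y\circ z)\mu(x,y)^{-1}=1$, and $\alpha(y,z)\mu(x,y+z)\alpha(-x,x)=\mu(x,z)\alpha(x\circ y,-x)\alpha(x\circ y-x,x\circ z)\mu(x,y)$. Factor sets form a group $Z^2_b(Q,K)$ under pointwise multiplication. For $h:Q\to K$ put $\partial_+h(x,y)=h(y)h(x+y)^{-1}h(x)$ and $\partial_\circ h(x,y)=h(y)h(x\circ y)^{-1}h(x)$. Let $B^2_b(Q,K)=\{(\partial_+h,\partial_\circ h): h:Q\to K,\ h(0)=1\}$ and $H^2_b(Q,K)=Z^2_b(Q,K)/B^2_b(Q,K)$.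 *)

theory Defs
  imports "HOL-Algebra.Algebra"
begin

section \<open>Skew braces\<close>

text \<open>
  A skew brace is represented by a ring record: the (not necessarily abelian) operation
  \<open>+\<close> is \<^term>\<open>ring.add Q\<close> with neutral element \<^term>\<open>ring.zero Q\<close>, and the circle operation is
  \<^term>\<open>monoid.mult Q\<close>.  No ring axioms are assumed.
\<close>

locale skew_brace =
  fixes Q :: "('a, 'm) ring_scheme" (structure)
  assumes add_group: "group (add_monoid Q)"
    and circ_group: "group Q"
    and brace: "\<lbrakk>a \<in> carrier Q; b \<in> carrier Q; c \<in> carrier Q\<rbrakk>
      \<Longrightarrow> a \<otimes> (b \<oplus> c) = ((a \<otimes> b) \<ominus> a) \<oplus> (a \<otimes> c)"

lemma (in skew_brace) one_eq_zero: "\<one> = \<zero>"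
proof -
  interpret A: group "add_monoid Q" by (rule add_group)
  interpret M: group Q by (rule circ_group)
  have z: "\<zero> \<in> carrier Q" using A.one_closed by simp
  have "\<one> \<otimes> (\<zero> \<oplus> \<zero>) = ((\<one> \<otimes> \<zero>) \<ominus> \<one>) \<oplus> (\<one> \<otimes> \<zero>)"
    using brace[of \<one> \<zero> \<zero>] z by simp
  then have "\<zero> = \<ominus> \<one>"
    using z A.l_one[of \<zero>] A.l_one[of "\<ominus> \<one>"] A.r_one[of "\<ominus> \<one>"] A.inv_closed[of \<one>]
    by (simp add: a_minus_def a_inv_def)
  then show ?thesis
    using A.inv_eq_1_iff[of \<one>] by (simp add: a_inv_def)
qed

definition trivial_skew_brace :: "('a, 'm) monoid_scheme \<Rightarrow> 'a ring" where
  "trivial_skew_brace G =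
     \<lparr>carrier = carrier G, monoid.mult = monoid.mult G, one = \<one>\<^bsub>G\<^esub>, ring.zero = \<one>\<^bsub>G\<^esub>, ring.add = monoid.mult G\<rparr>"

lemma skew_brace_trivial:
  assumes "group G"
  shows "skew_brace (trivial_skew_brace G)"
proof -
  interpret G: group G by fact
  have inv: "\<ominus>\<^bsub>trivial_skew_brace G\<^esub> x = inv\<^bsub>G\<^esub> x" for x
    by (simp add: a_inv_def m_inv_def trivial_skew_brace_def)
  have "group (add_monoid (trivial_skew_brace G))" "group (trivial_skew_brace G)"
    by (rule groupI; force simp: trivial_skew_brace_def G.m_assoc intro: G.l_inv_ex)+
  then show ?thesis
    by (intro skew_brace.intro)
       (simp_all add: inv a_minus_def, simp_all add: trivial_skew_brace_def G.m_assoc G.inv_solve_left)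
qed


section \<open>Second group cohomology with trivial coefficients\<close>

text \<open>
  Cochains are extensional functions, so that equality of functions on the carrier is
  equality.  Group cohomology is given by the inhomogeneous cochain complex, without
  normalisation.
\<close>

definition cochains2 ::
    "('a, 'm) monoid_scheme \<Rightarrow> ('b, 'n) monoid_scheme \<Rightarrow> ('a \<times> 'a \<Rightarrow> 'b) monoid" where
  "cochains2 G K = product_group (carrier G \<times> carrier G) (\<lambda>_. K)"

definition cocycles2 ::
    "('a, 'm) monoid_scheme \<Rightarrow> ('b, 'n) monoid_scheme \<Rightarrow> ('a \<times> 'a \<Rightarrow> 'b) set" where
  "cocycles2 G K = {\<alpha> \<in> carrier (cochains2 G K).
     \<forall>x\<in>carrier G. \<forall>y\<in>carrier G. \<forall>z\<in>carrier G.
       \<alpha> (y, z) \<otimes>\<^bsub>K\<^esub> inv\<^bsub>K\<^esub> (\<alpha> (x \<otimes>\<^bsub>G\<^esub> y, z)) \<otimes>\<^bsub>K\<^esub> \<alpha> (x, y \<otimes>\<^bsub>G\<^esub> z) \<otimes>\<^bsub>K\<^esub> inv\<^bsub>K\<^esub> (\<alpha> (x, y)) = \<one>\<^bsub>K\<^esub>}"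

definition coboundary1 ::
    "('a, 'm) monoid_scheme \<Rightarrow> ('b, 'n) monoid_scheme \<Rightarrow> ('a \<Rightarrow> 'b) \<Rightarrow> ('a \<times> 'a \<Rightarrow> 'b)" where
  "coboundary1 G K h =
     (\<lambda>(x, y)\<in>carrier G \<times> carrier G. h y \<otimes>\<^bsub>K\<^esub> inv\<^bsub>K\<^esub> (h (x \<otimes>\<^bsub>G\<^esub> y)) \<otimes>\<^bsub>K\<^esub> h x)"

definition H2 ::
    "('a, 'm) monoid_scheme \<Rightarrow> ('b, 'n) monoid_scheme \<Rightarrow> ('a \<times> 'a \<Rightarrow> 'b) set monoid" where
  "H2 G K = (cochains2 G K)\<lparr>carrier := cocycles2 G K\<rparr>
              Mod (coboundary1 G K ` (carrier G \<rightarrow>\<^sub>E carrier K))"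


section \<open>Second cohomology of skew braces\<close>

definition factor_sets ::
    "('a, 'm) ring_scheme \<Rightarrow> ('b, 'n) monoid_scheme
      \<Rightarrow> (('a \<times> 'a \<Rightarrow> 'b) \<times> ('a \<times> 'a \<Rightarrow> 'b)) set" where
  "factor_sets Q K = {(\<alpha>, \<mu>).
     \<alpha> \<in> cocycles2 (add_monoid Q) K \<and> \<mu> \<in> cocycles2 Q K \<and>
     (\<forall>x\<in>carrier Q. \<alpha> (\<zero>\<^bsub>Q\<^esub>, x) = \<one>\<^bsub>K\<^esub> \<and> \<alpha> (x, \<zero>\<^bsub>Q\<^esub>) = \<one>\<^bsub>K\<^esub> \<and>
                    \<mu> (\<zero>\<^bsub>Q\<^esub>, x) = \<one>\<^bsub>K\<^esub> \<and> \<mu> (x, \<zero>\<^bsub>Q\<^esub>) = \<one>\<^bsub>K\<^esub>) \<and>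
     (\<forall>x\<in>carrier Q. \<forall>y\<in>carrier Q. \<forall>z\<in>carrier Q.
       \<alpha> (y, z) \<otimes>\<^bsub>K\<^esub> \<mu> (x, y \<oplus>\<^bsub>Q\<^esub> z) \<otimes>\<^bsub>K\<^esub> \<alpha> (\<ominus>\<^bsub>Q\<^esub> x, x) =
       \<mu> (x, z) \<otimes>\<^bsub>K\<^esub> \<alpha> (x \<otimes>\<^bsub>Q\<^esub> y, \<ominus>\<^bsub>Q\<^esub> x)
         \<otimes>\<^bsub>K\<^esub> \<alpha> ((x \<otimes>\<^bsub>Q\<^esub> y) \<ominus>\<^bsub>Q\<^esub> x, x \<otimes>\<^bsub>Q\<^esub> z) \<otimes>\<^bsub>K\<^esub> \<mu> (x, y))}"

definition Z2_b ::
    "('a, 'm) ring_scheme \<Rightarrow> ('b, 'n) monoid_scheme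
      \<Rightarrow> (('a \<times> 'a \<Rightarrow> 'b) \<times> ('a \<times> 'a \<Rightarrow> 'b)) monoid" where
  "Z2_b Q K = (cochains2 (add_monoid Q) K \<times>\<times> cochains2 Q K)\<lparr>carrier := factor_sets Q K\<rparr>"

definition B2_b ::
    "('a, 'm) ring_scheme \<Rightarrow> ('b, 'n) monoid_scheme
      \<Rightarrow> (('a \<times> 'a \<Rightarrow> 'b) \<times> ('a \<times> 'a \<Rightarrow> 'b)) set" where
  "B2_b Q K = {(coboundary1 (add_monoid Q) K h, coboundary1 Q K h) |h.
     h \<in> carrier Q \<rightarrow>\<^sub>E carrier K \<and> h \<zero>\<^bsub>Q\<^esub> = \<one>\<^bsub>K\<^esub>}"

definition H2_b ::
    "('a, 'm) ring_scheme \<Rightarrow> ('b, 'n) monoid_scheme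
      \<Rightarrow> (('a \<times> 'a \<Rightarrow> 'b) \<times> ('a \<times> 'a \<Rightarrow> 'b)) set monoid" where
  "H2_b Q K = Z2_b Q K Mod B2_b Q K"


section \<open>The group of homomorphisms\<close>

text \<open>
  Pointwise multiplication on homomorphisms into an abelian group.  The library set
  \<^term>\<open>hom G K\<close> does not fix values outside the carrier, hence the restriction to
  extensional functions.
\<close>

definition Hom_group ::
    "('a, 'm) monoid_scheme \<Rightarrow> ('b, 'n) monoid_scheme \<Rightarrow> ('a \<Rightarrow> 'b) monoid" where
  "Hom_group G K =
     (product_group (carrier G) (\<lambda>_. K))\<lparr>carrier := hom G K \<inter> extensional (carrier G)\<rparr>"

end

theory Submission
  imports Defs
begin

text \<open>
  Over the trivial skew brace of \<open>G\<close>, every normalised cocycle \<open>\<alpha>\<close> gives a factor set \<open>(\<alpha>, \<alpha>)\<close>.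
  Hence, writing \<open>\<mu> = \<alpha> \<beta>\<close>, the compatibility condition for \<open>(\<alpha>, \<mu>)\<close> says that \<open>\<beta>\<close> is
  multiplicative in the second argument; the cocycle condition then makes \<open>\<beta>\<close> multiplicative in the
  first one as well, and conversely every bimultiplicative \<open>\<beta>\<close> is a normalised cocycle.  Sending
  \<open>(\<alpha>, \<mu>)\<close> to the class of \<open>\<alpha>\<close> and the map \<open>\<beta>\<close> is a surjective homomorphism, because every
  cocycle differs from a normalised one by the coboundary of a constant.  In its kernel, \<open>\<beta> = 1\<close> and
  \<open>\<alpha>\<close> is the coboundary of some \<open>h\<close>, where \<open>h 1 = \<alpha> (1, 1) = 1\<close>.
\<close>

section \<open>Groups of functions and of homomorphisms under pointwise multiplication\<close>

lemma comm_group_product_group: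
  assumes "\<And>i. i \<in> I \<Longrightarrow> comm_group (G i)"
  shows "comm_group (product_group I G)"
proof (rule group.group_comm_groupI)
  show "group (product_group I G)"
    using assms by (simp add: comm_group.axioms(2))
next
  fix f g assume "f \<in> carrier (product_group I G)" "g \<in> carrier (product_group I G)"
  then have "f i \<otimes>\<^bsub>G i\<^esub> g i = g i \<otimes>\<^bsub>G i\<^esub> f i" if "i \<in> I" for i
    using that comm_groupE(4)[OF assms[OF that], of "f i" "g i"] by (auto simp: PiE_iff)
  then show "f \<otimes>\<^bsub>product_group I G\<^esub> g = g \<otimes>\<^bsub>product_group I G\<^esub> f"
    by (auto intro: restrict_ext)
qed

lemma (in comm_group) subgroup_is_comm_group:
  assumes "subgroup H G"
  shows "comm_group (G\<lparr>carrier := H\<rparr>)"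
  using assms
  by (intro group.group_comm_groupI subgroup_imp_group) (auto intro: m_comm dest: subgroup.mem_carrier)

text \<open>Multiplies two identities of the shape of the cocycle condition; this gives closure of
  cocycles under products.\<close>

lemma (in comm_group) mult_eq_mult:
  assumes "a \<otimes> b = c \<otimes> d" "a' \<otimes> b' = c' \<otimes> d'"
    and "a \<in> carrier G" "b \<in> carrier G" "c \<in> carrier G" "d \<in> carrier G"
    and "a' \<in> carrier G" "b' \<in> carrier G" "c' \<in> carrier G" "d' \<in> carrier G"
  shows "(a \<otimes> a') \<otimes> (b \<otimes> b') = (c \<otimes> c') \<otimes> (d \<otimes> d')"
proof -
  have "(a \<otimes> a') \<otimes> (b \<otimes> b') = (a \<otimes> b) \<otimes> (a' \<otimes> b')"
    using assms(3-) by (simp add: m_ac)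
  also have "\<dots> = (c \<otimes> c') \<otimes> (d \<otimes> d')"
    unfolding assms(1,2) using assms(3-) by (simp add: m_ac)
  finally show ?thesis .
qed

text \<open>Commutativity of \<open>K\<close> makes pointwise products and inverses of homomorphisms
  multiplicative. As the outcome is again a commutative group, the lemma can be applied to its own
  result, which yields Hom(G, Hom(G, K)).\<close>

lemma (in group) comm_group_Hom_group:
  assumes "comm_group K"
  shows "comm_group (Hom_group G K)"
proof -
  interpret K: comm_group K by fact
  interpret P: comm_group "product_group (carrier G) (\<lambda>_. K)"
    by (rule comm_group_product_group) (rule assms)
  have "subgroup (hom G K \<inter> extensional (carrier G)) (product_group (carrier G) (\<lambda>_. K))"
  proof (rule P.subgroupI)
    show "hom G K \<inter> extensional (carrier G) \<subseteq> carrier (product_group (carrier G) (\<lambda>_. K))"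
      by (auto simp: hom_def PiE_def)
    have "(\<lambda>x\<in>carrier G. \<one>\<^bsub>K\<^esub>) \<in> hom G K \<inter> extensional (carrier G)"
      by (auto simp: hom_def)
    then show "hom G K \<inter> extensional (carrier G) \<noteq> {}"
      by blast
  next
    fix f assume f: "f \<in> hom G K \<inter> extensional (carrier G)"
    then have "inv\<^bsub>product_group (carrier G) (\<lambda>_. K)\<^esub> f = (\<lambda>x\<in>carrier G. inv\<^bsub>K\<^esub> f x)"
      by (subst inv_product_group) (auto simp: hom_def PiE_def)
    then show "inv\<^bsub>product_group (carrier G) (\<lambda>_. K)\<^esub> f \<in> hom G K \<inter> extensional (carrier G)"
      using f by (auto simp: hom_def Pi_iff K.inv_mult)
  next
    fix f g assume "f \<in> hom G K \<inter> extensional (carrier G)" "g \<in> hom G K \<inter> extensional (carrier G)"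
    then show "f \<otimes>\<^bsub>product_group (carrier G) (\<lambda>_. K)\<^esub> g \<in> hom G K \<inter> extensional (carrier G)"
      by (auto simp: hom_def Pi_iff K.m_ac)
  qed
  then show ?thesis
    unfolding Hom_group_def by (rule P.subgroup_is_comm_group)
qed

section \<open>Cochains, cocycles and coboundaries with trivial coefficients\<close>

locale trivial_coefficients = G: group G + K: comm_group K
  for G :: "('a, 'm) monoid_scheme" and K :: "('b, 'n) monoid_scheme"
begin

lemma carrier_cochains2: "carrier (cochains2 G K) = carrier G \<times> carrier G \<rightarrow>\<^sub>E carrier K"
  by (simp add: cochains2_def)

lemma cochain_closed [simp]:
  "\<alpha> \<in> carrier (cochains2 G K) \<Longrightarrow> x \<in> carrier G \<Longrightarrow> y \<in> carrier G \<Longrightarrow> \<alpha> (x, y) \<in> carrier K"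
  by (auto simp: carrier_cochains2)

lemma cochain_eqI:
  assumes "\<alpha> \<in> carrier (cochains2 G K)" "\<beta> \<in> carrier (cochains2 G K)"
    and "\<And>x y. x \<in> carrier G \<Longrightarrow> y \<in> carrier G \<Longrightarrow> \<alpha> (x, y) = \<beta> (x, y)"
  shows "\<alpha> = \<beta>"
  using assms unfolding carrier_cochains2 by (intro PiE_ext[of \<alpha> _ _ \<beta>]) auto

lemma mult_cochains2 [simp]:
  "x \<in> carrier G \<Longrightarrow> y \<in> carrier G \<Longrightarrow>
    (\<alpha> \<otimes>\<^bsub>cochains2 G K\<^esub> \<beta>) (x, y) = \<alpha> (x, y) \<otimes>\<^bsub>K\<^esub> \<beta> (x, y)"
  by (simp add: cochains2_def)

lemma one_cochains2 [simp]:
  "x \<in> carrier G \<Longrightarrow> y \<in> carrier G \<Longrightarrow> \<one>\<^bsub>cochains2 G K\<^esub> (x, y) = \<one>\<^bsub>K\<^esub>"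
  by (simp add: cochains2_def)

lemma inv_cochains2 [simp]:
  assumes "\<alpha> \<in> carrier (cochains2 G K)" "x \<in> carrier G" "y \<in> carrier G"
  shows "(inv\<^bsub>cochains2 G K\<^esub> \<alpha>) (x, y) = inv\<^bsub>K\<^esub> (\<alpha> (x, y))"
  using assms unfolding cochains2_def by (subst inv_product_group) auto

sublocale C: comm_group "cochains2 G K"
  unfolding cochains2_def by (rule comm_group_product_group) (rule K.comm_group_axioms)

text \<open>In an abelian group the inverted factors can be moved to the other side. The form
  without inverses suits rewriting by associativity, commutativity and cancellation, and is the one
  used from here on.\<close>

lemma cocycles2_iff:
  "\<alpha> \<in> cocycles2 G K \<longleftrightarrow> \<alpha> \<in> carrier (cochains2 G K) \<and>
    (\<forall>x\<in>carrier G. \<forall>y\<in>carrier G. \<forall>z\<in>carrier G.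
      \<alpha> (y, z) \<otimes>\<^bsub>K\<^esub> \<alpha> (x, y \<otimes>\<^bsub>G\<^esub> z) = \<alpha> (x \<otimes>\<^bsub>G\<^esub> y, z) \<otimes>\<^bsub>K\<^esub> \<alpha> (x, y))"
proof -
  have *: "a \<otimes>\<^bsub>K\<^esub> inv\<^bsub>K\<^esub> b \<otimes>\<^bsub>K\<^esub> c \<otimes>\<^bsub>K\<^esub> inv\<^bsub>K\<^esub> d = \<one>\<^bsub>K\<^esub> \<longleftrightarrow> a \<otimes>\<^bsub>K\<^esub> c = b \<otimes>\<^bsub>K\<^esub> d"
    if "a \<in> carrier K" "b \<in> carrier K" "c \<in> carrier K" "d \<in> carrier K" for a b c d
  proof -
    have "a \<otimes>\<^bsub>K\<^esub> inv\<^bsub>K\<^esub> b \<otimes>\<^bsub>K\<^esub> c \<otimes>\<^bsub>K\<^esub> inv\<^bsub>K\<^esub> d = (a \<otimes>\<^bsub>K\<^esub> c) \<otimes>\<^bsub>K\<^esub> inv\<^bsub>K\<^esub> (b \<otimes>\<^bsub>K\<^esub> d)"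
      using that by (simp add: K.inv_mult K.m_ac)
    then show ?thesis
      using that by (metis K.inv_closed K.inv_equality K.inv_inv K.m_closed K.r_inv)
  qed
  show ?thesis
    unfolding cocycles2_def by (auto simp: *)
qed

lemma cocycle_closed: "\<alpha> \<in> cocycles2 G K \<Longrightarrow> \<alpha> \<in> carrier (cochains2 G K)"
  by (simp add: cocycles2_iff)

lemma cocycle_eq:
  assumes "\<alpha> \<in> cocycles2 G K" "x \<in> carrier G" "y \<in> carrier G" "z \<in> carrier G"
  shows "\<alpha> (y, z) \<otimes>\<^bsub>K\<^esub> \<alpha> (x, y \<otimes>\<^bsub>G\<^esub> z) = \<alpha> (x \<otimes>\<^bsub>G\<^esub> y, z) \<otimes>\<^bsub>K\<^esub> \<alpha> (x, y)"
  using assms by (simp add: cocycles2_iff)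

lemma subgroup_cocycles2: "subgroup (cocycles2 G K) (cochains2 G K)"
proof (rule C.subgroupI)
  show "cocycles2 G K \<subseteq> carrier (cochains2 G K)"
    by (auto simp: cocycles2_iff)
  have "\<one>\<^bsub>cochains2 G K\<^esub> \<in> cocycles2 G K"
    by (simp add: cocycles2_iff)
  then show "cocycles2 G K \<noteq> {}"
    by blast
next
  fix \<alpha> assume "\<alpha> \<in> cocycles2 G K"
  then show "inv\<^bsub>cochains2 G K\<^esub> \<alpha> \<in> cocycles2 G K"
    by (auto simp: cocycles2_iff K.inv_mult[symmetric])
next
  fix \<alpha> \<beta> assume "\<alpha> \<in> cocycles2 G K" "\<beta> \<in> cocycles2 G K"
  then show "\<alpha> \<otimes>\<^bsub>cochains2 G K\<^esub> \<beta> \<in> cocycles2 G K"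
    by (auto simp: cocycles2_iff intro!: K.mult_eq_mult)
qed

abbreviation Z2 where "Z2 \<equiv> (cochains2 G K)\<lparr>carrier := cocycles2 G K\<rparr>"
abbreviation B2 where "B2 \<equiv> coboundary1 G K ` (carrier G \<rightarrow>\<^sub>E carrier K)"

sublocale Z: comm_group Z2
  by (rule C.subgroup_is_comm_group) (rule subgroup_cocycles2)

lemma coboundary1_apply [simp]:
  "x \<in> carrier G \<Longrightarrow> y \<in> carrier G \<Longrightarrow>
    coboundary1 G K h (x, y) = h y \<otimes>\<^bsub>K\<^esub> inv\<^bsub>K\<^esub> (h (x \<otimes>\<^bsub>G\<^esub> y)) \<otimes>\<^bsub>K\<^esub> h x"
  by (simp add: coboundary1_def)

lemma coboundary1_cochain:
  "h \<in> carrier G \<rightarrow>\<^sub>E carrier K \<Longrightarrow> coboundary1 G K h \<in> carrier (cochains2 G K)"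
  by (auto simp: carrier_cochains2 coboundary1_def PiE_iff)

lemma coboundary1_cocycle:
  assumes h: "h \<in> carrier G \<rightarrow>\<^sub>E carrier K"
  shows "coboundary1 G K h \<in> cocycles2 G K"
proof -
  \<comment> \<open>The letters stand for the values of \<open>h\<close> at x, y, z
    (\<open>a\<close>, \<open>b\<close>, \<open>c\<close>) and at the products xy, yz, xyz
    (\<open>ab\<close>, \<open>bc\<close>, \<open>abc\<close>). After cancelling \<open>bc\<close>
    on the left and \<open>ab\<close> on the right, both sides are the product of \<open>a\<close>,
    \<open>b\<close>, \<open>c\<close> and the inverse of \<open>abc\<close>.\<close>
  have "(c \<otimes>\<^bsub>K\<^esub> inv\<^bsub>K\<^esub> bc \<otimes>\<^bsub>K\<^esub> b) \<otimes>\<^bsub>K\<^esub> (bc \<otimes>\<^bsub>K\<^esub> inv\<^bsub>K\<^esub> abc \<otimes>\<^bsub>K\<^esub> a) =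
        (c \<otimes>\<^bsub>K\<^esub> inv\<^bsub>K\<^esub> abc \<otimes>\<^bsub>K\<^esub> ab) \<otimes>\<^bsub>K\<^esub> (b \<otimes>\<^bsub>K\<^esub> inv\<^bsub>K\<^esub> ab \<otimes>\<^bsub>K\<^esub> a)"
    if "a \<in> carrier K" "b \<in> carrier K" "c \<in> carrier K" "ab \<in> carrier K" "bc \<in> carrier K"
       "abc \<in> carrier K" for a b c ab bc abc
  proof -
    \<comment> \<open>The cancellation rules are switched off so that the pair formed by
      \<open>bc\<close> and its inverse survives on both sides while the factors are sorted.\<close>
    have "(c \<otimes>\<^bsub>K\<^esub> inv\<^bsub>K\<^esub> bc \<otimes>\<^bsub>K\<^esub> b) \<otimes>\<^bsub>K\<^esub> (bc \<otimes>\<^bsub>K\<^esub> inv\<^bsub>K\<^esub> abc \<otimes>\<^bsub>K\<^esub> a) =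
        (inv\<^bsub>K\<^esub> bc \<otimes>\<^bsub>K\<^esub> bc) \<otimes>\<^bsub>K\<^esub> (a \<otimes>\<^bsub>K\<^esub> b \<otimes>\<^bsub>K\<^esub> c \<otimes>\<^bsub>K\<^esub> inv\<^bsub>K\<^esub> abc)"
      using that by (simp add: K.m_ac del: K.l_inv K.r_inv K.Units_l_inv K.Units_r_inv)
    moreover have "(c \<otimes>\<^bsub>K\<^esub> inv\<^bsub>K\<^esub> abc \<otimes>\<^bsub>K\<^esub> ab) \<otimes>\<^bsub>K\<^esub> (b \<otimes>\<^bsub>K\<^esub> inv\<^bsub>K\<^esub> ab \<otimes>\<^bsub>K\<^esub> a) =
        (inv\<^bsub>K\<^esub> ab \<otimes>\<^bsub>K\<^esub> ab) \<otimes>\<^bsub>K\<^esub> (a \<otimes>\<^bsub>K\<^esub> b \<otimes>\<^bsub>K\<^esub> c \<otimes>\<^bsub>K\<^esub> inv\<^bsub>K\<^esub> abc)"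
      using that by (simp add: K.m_ac del: K.l_inv K.r_inv K.Units_l_inv K.Units_r_inv)
    ultimately show ?thesis
      using that by simp
  qed
  then show ?thesis
    using h by (auto simp: cocycles2_iff coboundary1_cochain G.m_assoc PiE_iff)
qed

text \<open>Since \<open>K\<close> is abelian, the coboundary map is a homomorphism from the group
  of all functions into the cocycles, and the image of a homomorphism is a subgroup.\<close>

lemma subgroup_coboundaries2: "subgroup B2 Z2"
proof -
  interpret P: comm_group "product_group (carrier G) (\<lambda>_. K)"
    by (rule comm_group_product_group) (rule K.comm_group_axioms)
  have "coboundary1 G K \<in> hom (product_group (carrier G) (\<lambda>_. K)) Z2"
  proof (rule homI)
    fix h k assume hk: "h \<in> carrier (product_group (carrier G) (\<lambda>_. K))"
      "k \<in> carrier (product_group (carrier G) (\<lambda>_. K))"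
    have "h \<otimes>\<^bsub>product_group (carrier G) (\<lambda>_. K)\<^esub> k \<in> carrier G \<rightarrow>\<^sub>E carrier K"
      using P.m_closed[OF hk] by simp
    then show "coboundary1 G K (h \<otimes>\<^bsub>product_group (carrier G) (\<lambda>_. K)\<^esub> k) =
        coboundary1 G K h \<otimes>\<^bsub>Z2\<^esub> coboundary1 G K k"
      using hk by (intro cochain_eqI) (auto simp: coboundary1_cochain PiE_iff K.inv_mult K.m_ac)
  qed (auto simp: coboundary1_cocycle)
  then interpret group_hom "product_group (carrier G) (\<lambda>_. K)" Z2 "coboundary1 G K"
    by unfold_locales
  show ?thesis
    using img_is_subgroup by simp
qed

sublocale B: normal B2 Z2
  by (rule Z.subgroup_imp_normal) (rule subgroup_coboundaries2)

text \<open>Cancel in the cocycle identities at (1, 1, x) and (x, 1, 1). Normalisation of a cocycle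
  thus comes down to its single value at (1, 1).\<close>

lemma cocycle_one:
  assumes "\<alpha> \<in> cocycles2 G K" "x \<in> carrier G"
  shows "\<alpha> (\<one>\<^bsub>G\<^esub>, x) = \<alpha> (\<one>\<^bsub>G\<^esub>, \<one>\<^bsub>G\<^esub>)" "\<alpha> (x, \<one>\<^bsub>G\<^esub>) = \<alpha> (\<one>\<^bsub>G\<^esub>, \<one>\<^bsub>G\<^esub>)"
  using cocycle_eq[OF assms(1), of "\<one>\<^bsub>G\<^esub>" "\<one>\<^bsub>G\<^esub>" x] cocycle_eq[OF assms(1), of x "\<one>\<^bsub>G\<^esub>" "\<one>\<^bsub>G\<^esub>"]
    assms cocycle_closed[OF assms(1)]
  by (auto simp: K.m_comm)

section \<open>Bimultiplicative maps and normalised cocycles\<close>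

text \<open>This is the map \<beta> with \<mu> = \<alpha> \<beta>. It is curried and restricted in
  both arguments, because the elements of \<open>Hom_group G (Hom_group G K)\<close> have this
  form.\<close>

definition ratio :: "('a \<times> 'a \<Rightarrow> 'b) \<times> ('a \<times> 'a \<Rightarrow> 'b) \<Rightarrow> 'a \<Rightarrow> 'a \<Rightarrow> 'b" where
  "ratio p = (\<lambda>x\<in>carrier G. \<lambda>y\<in>carrier G. snd p (x, y) \<otimes>\<^bsub>K\<^esub> inv\<^bsub>K\<^esub> (fst p (x, y)))"

text \<open>Multiplicativity in the first argument is an equation between elements of Hom(G, K); as
  these are extensional functions, it can be tested pointwise.\<close>

lemma Hom_Hom_iff:
  "b \<in> carrier (Hom_group G (Hom_group G K)) \<longleftrightarrow>
    b \<in> (carrier G \<rightarrow>\<^sub>E (carrier G \<rightarrow>\<^sub>E carrier K)) \<and>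
    (\<forall>x\<in>carrier G. \<forall>y\<in>carrier G. \<forall>z\<in>carrier G.
      b (x \<otimes>\<^bsub>G\<^esub> y) z = b x z \<otimes>\<^bsub>K\<^esub> b y z \<and> b x (y \<otimes>\<^bsub>G\<^esub> z) = b x y \<otimes>\<^bsub>K\<^esub> b x z)"
  (is "?L \<longleftrightarrow> ?R")
proof
  assume L: ?L
  then have "b (x \<otimes>\<^bsub>G\<^esub> y) z = b x z \<otimes>\<^bsub>K\<^esub> b y z"
    if "x \<in> carrier G" "y \<in> carrier G" "z \<in> carrier G" for x y z
    using that by (simp add: Hom_group_def hom_def)
  moreover have "b x (y \<otimes>\<^bsub>G\<^esub> z) = b x y \<otimes>\<^bsub>K\<^esub> b x z"
    if "x \<in> carrier G" "y \<in> carrier G" "z \<in> carrier G" for x y z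
    using that L by (auto simp: Hom_group_def hom_def Pi_iff)
  moreover have "b \<in> (carrier G \<rightarrow>\<^sub>E (carrier G \<rightarrow>\<^sub>E carrier K))"
    using L by (auto simp: Hom_group_def hom_def Pi_iff PiE_iff)
  ultimately show ?R by blast
next
  assume R: ?R
  have "b (x \<otimes>\<^bsub>G\<^esub> y) = (\<lambda>z\<in>carrier G. b x z \<otimes>\<^bsub>K\<^esub> b y z)"
    if "x \<in> carrier G" "y \<in> carrier G" for x y
    using R that by (intro extensionalityI[where A = "carrier G"]) (auto simp: PiE_iff)
  then show ?L
    using R by (auto simp: Hom_group_def hom_def Pi_iff PiE_iff)
qed

text \<open>This is the case \<open>\<mu> = \<alpha>\<close> of the compatibility condition in the definition of a factor set.\<close>

lemma normalised_cocycle_compat: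
  assumes \<alpha>: "\<alpha> \<in> cocycles2 G K" and one: "\<alpha> (\<one>\<^bsub>G\<^esub>, \<one>\<^bsub>G\<^esub>) = \<one>\<^bsub>K\<^esub>"
    and xyz: "x \<in> carrier G" "y \<in> carrier G" "z \<in> carrier G"
  shows "\<alpha> (y, z) \<otimes>\<^bsub>K\<^esub> \<alpha> (x, y \<otimes>\<^bsub>G\<^esub> z) \<otimes>\<^bsub>K\<^esub> \<alpha> (inv\<^bsub>G\<^esub> x, x) =
    \<alpha> (x, z) \<otimes>\<^bsub>K\<^esub> \<alpha> (x \<otimes>\<^bsub>G\<^esub> y, inv\<^bsub>G\<^esub> x) \<otimes>\<^bsub>K\<^esub>
      \<alpha> (x \<otimes>\<^bsub>G\<^esub> y \<otimes>\<^bsub>G\<^esub> inv\<^bsub>G\<^esub> x, x \<otimes>\<^bsub>G\<^esub> z) \<otimes>\<^bsub>K\<^esub> \<alpha> (x, y)"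
proof -
  note [simp] = cocycle_closed[OF \<alpha>]
  define w where "w = x \<otimes>\<^bsub>G\<^esub> y"
  have w [simp]: "w \<in> carrier G" using xyz by (simp add: w_def)
  \<comment> \<open>Three instances of the cocycle identity are combined: at (xy, x^-1, xz), at
    (x^-1, x, z) and at (x, y, z). Normalisation enters through the second, where the factor at
    (x^-1 x, z) = (1, z) is trivial.\<close>
  have "inv\<^bsub>G\<^esub> x \<otimes>\<^bsub>G\<^esub> (x \<otimes>\<^bsub>G\<^esub> z) = z"
    using xyz by (simp flip: G.m_assoc)
  then have 1: "\<alpha> (inv\<^bsub>G\<^esub> x, x \<otimes>\<^bsub>G\<^esub> z) \<otimes>\<^bsub>K\<^esub> \<alpha> (w, z) =
      \<alpha> (w \<otimes>\<^bsub>G\<^esub> inv\<^bsub>G\<^esub> x, x \<otimes>\<^bsub>G\<^esub> z) \<otimes>\<^bsub>K\<^esub> \<alpha> (w, inv\<^bsub>G\<^esub> x)"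
    using cocycle_eq[OF \<alpha>, of w "inv\<^bsub>G\<^esub> x" "x \<otimes>\<^bsub>G\<^esub> z"] xyz by simp
  have 2: "\<alpha> (x, z) \<otimes>\<^bsub>K\<^esub> \<alpha> (inv\<^bsub>G\<^esub> x, x \<otimes>\<^bsub>G\<^esub> z) = \<alpha> (inv\<^bsub>G\<^esub> x, x)"
    using cocycle_eq[OF \<alpha>, of "inv\<^bsub>G\<^esub> x" x z] cocycle_one(1)[OF \<alpha>, of z] one xyz by simp
  have "\<alpha> (x, z) \<otimes>\<^bsub>K\<^esub> \<alpha> (w, inv\<^bsub>G\<^esub> x) \<otimes>\<^bsub>K\<^esub> \<alpha> (w \<otimes>\<^bsub>G\<^esub> inv\<^bsub>G\<^esub> x, x \<otimes>\<^bsub>G\<^esub> z) \<otimes>\<^bsub>K\<^esub> \<alpha> (x, y) =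
      \<alpha> (x, z) \<otimes>\<^bsub>K\<^esub> (\<alpha> (w \<otimes>\<^bsub>G\<^esub> inv\<^bsub>G\<^esub> x, x \<otimes>\<^bsub>G\<^esub> z) \<otimes>\<^bsub>K\<^esub> \<alpha> (w, inv\<^bsub>G\<^esub> x)) \<otimes>\<^bsub>K\<^esub> \<alpha> (x, y)"
    using xyz by (simp add: K.m_ac)
  also have "\<dots> = (\<alpha> (x, z) \<otimes>\<^bsub>K\<^esub> \<alpha> (inv\<^bsub>G\<^esub> x, x \<otimes>\<^bsub>G\<^esub> z)) \<otimes>\<^bsub>K\<^esub> (\<alpha> (w, z) \<otimes>\<^bsub>K\<^esub> \<alpha> (x, y))"
    using xyz by (simp add: K.m_assoc flip: 1)
  also have "\<dots> = \<alpha> (inv\<^bsub>G\<^esub> x, x) \<otimes>\<^bsub>K\<^esub> (\<alpha> (y, z) \<otimes>\<^bsub>K\<^esub> \<alpha> (x, y \<otimes>\<^bsub>G\<^esub> z))"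
    using xyz by (simp add: 2 w_def cocycle_eq[OF \<alpha>])
  finally show ?thesis
    using xyz by (simp add: w_def K.m_ac)
qed

section \<open>Factor sets of the trivial skew brace\<close>

abbreviation Q where "Q \<equiv> trivial_skew_brace G"

lemma trivial_skew_brace_simps [simp]:
  "carrier Q = carrier G" "monoid.mult Q = monoid.mult G" "ring.add Q = monoid.mult G"
  "\<zero>\<^bsub>Q\<^esub> = \<one>\<^bsub>G\<^esub>" "\<ominus>\<^bsub>Q\<^esub> x = inv\<^bsub>G\<^esub> x" "x \<ominus>\<^bsub>Q\<^esub> y = x \<otimes>\<^bsub>G\<^esub> inv\<^bsub>G\<^esub> y"
  by (simp_all add: trivial_skew_brace_def a_minus_def a_inv_def m_inv_def)

text \<open>The record displayed here is the simp normal form of \<^term>\<open>add_monoid Q\<close>.\<close>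

lemma trivial_skew_brace_cohomology_simps [simp]:
  fixes G' :: "'a monoid"
  defines "G' \<equiv> \<lparr>carrier = carrier G, monoid.mult = monoid.mult G, one = \<one>\<^bsub>G\<^esub>\<rparr>"
  shows "cochains2 G' K = cochains2 G K" "cochains2 Q K = cochains2 G K"
    "cocycles2 G' K = cocycles2 G K" "cocycles2 Q K = cocycles2 G K"
    "coboundary1 G' K = coboundary1 G K" "coboundary1 Q K = coboundary1 G K"
  by (simp_all add: G'_def cochains2_def cocycles2_def coboundary1_def fun_eq_iff)

lemma ratio_apply [simp]:
  "x \<in> carrier G \<Longrightarrow> y \<in> carrier G \<Longrightarrow> ratio (\<alpha>, \<mu>) x y = \<mu> (x, y) \<otimes>\<^bsub>K\<^esub> inv\<^bsub>K\<^esub> (\<alpha> (x, y))"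
  by (simp add: ratio_def)

lemma ratio_carrier:
  "\<alpha> \<in> carrier (cochains2 G K) \<Longrightarrow> \<mu> \<in> carrier (cochains2 G K) \<Longrightarrow>
    ratio (\<alpha>, \<mu>) \<in> (carrier G \<rightarrow>\<^sub>E (carrier G \<rightarrow>\<^sub>E carrier K))"
  by (auto simp: ratio_def)

text \<open>Trades the normalisation, cocycle and compatibility conditions on \<mu> for
  bimultiplicativity of the ratio. The group structure on factor sets and the properties of
  \<open>splitting\<close> are all derived from this description.\<close>

lemma factor_sets_iff:
  "(\<alpha>, \<mu>) \<in> factor_sets Q K \<longleftrightarrow>
    \<alpha> \<in> cocycles2 G K \<and> \<alpha> (\<one>\<^bsub>G\<^esub>, \<one>\<^bsub>G\<^esub>) = \<one>\<^bsub>K\<^esub> \<and> \<mu> \<in> carrier (cochains2 G K) \<and>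
    ratio (\<alpha>, \<mu>) \<in> carrier (Hom_group G (Hom_group G K))"
  (is "?L \<longleftrightarrow> ?R")
proof -
  \<comment> \<open>The conditions in the first case are negations of consequences of either side,
    so both sides are false there. In the second case they are available as facts.\<close>
  consider "\<not> (\<alpha> \<in> cocycles2 G K \<and> \<alpha> (\<one>\<^bsub>G\<^esub>, \<one>\<^bsub>G\<^esub>) = \<one>\<^bsub>K\<^esub> \<and> \<mu> \<in> carrier (cochains2 G K))"
    | "\<alpha> \<in> cocycles2 G K" "\<alpha> (\<one>\<^bsub>G\<^esub>, \<one>\<^bsub>G\<^esub>) = \<one>\<^bsub>K\<^esub>" "\<mu> \<in> carrier (cochains2 G K)"
    by blast
  then show ?thesis
  proof cases
    case 1
    then show ?thesis
      using cocycle_closed[of \<mu>] by (auto simp: factor_sets_def)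
  next
    case 2
    note \<alpha> = 2(1) and one = 2(2)
    note [simp] = cocycle_closed[OF \<alpha>] 2(3)
    define \<beta> where "\<beta> = ratio (\<alpha>, \<mu>)"
    have \<beta> [simp]: "\<beta> x y \<in> carrier K" if "x \<in> carrier G" "y \<in> carrier G" for x y
      using that by (simp add: \<beta>_def)
    have \<mu>: "\<mu> (x, y) = \<alpha> (x, y) \<otimes>\<^bsub>K\<^esub> \<beta> x y" if "x \<in> carrier G" "y \<in> carrier G" for x y
    proof -
      have "\<alpha> (x, y) \<otimes>\<^bsub>K\<^esub> \<beta> x y = (\<alpha> (x, y) \<otimes>\<^bsub>K\<^esub> inv\<^bsub>K\<^esub> \<alpha> (x, y)) \<otimes>\<^bsub>K\<^esub> \<mu> (x, y)"
        using that by (simp add: \<beta>_def K.m_ac del: K.r_inv K.Units_r_inv)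
      then show ?thesis using that by simp
    qed
    have compat: "\<alpha> (y, z) \<otimes>\<^bsub>K\<^esub> \<mu> (x, y \<otimes>\<^bsub>G\<^esub> z) \<otimes>\<^bsub>K\<^esub> \<alpha> (inv\<^bsub>G\<^esub> x, x) =
        \<mu> (x, z) \<otimes>\<^bsub>K\<^esub> \<alpha> (x \<otimes>\<^bsub>G\<^esub> y, inv\<^bsub>G\<^esub> x) \<otimes>\<^bsub>K\<^esub>
          \<alpha> (x \<otimes>\<^bsub>G\<^esub> y \<otimes>\<^bsub>G\<^esub> inv\<^bsub>G\<^esub> x, x \<otimes>\<^bsub>G\<^esub> z) \<otimes>\<^bsub>K\<^esub> \<mu> (x, y)
        \<longleftrightarrow> \<beta> x (y \<otimes>\<^bsub>G\<^esub> z) = \<beta> x y \<otimes>\<^bsub>K\<^esub> \<beta> x z"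
      (is "?lhs = ?rhs \<longleftrightarrow> _") if xyz: "x \<in> carrier G" "y \<in> carrier G" "z \<in> carrier G" for x y z
    proof -
      \<comment> \<open>By \<open>normalised_cocycle_compat\<close>, \<open>c\<close> is also the
        product of the \<alpha>-factors on the right-hand side, so it cancels and only \<beta>
        remains.\<close>
      define c where "c = \<alpha> (y, z) \<otimes>\<^bsub>K\<^esub> \<alpha> (x, y \<otimes>\<^bsub>G\<^esub> z) \<otimes>\<^bsub>K\<^esub> \<alpha> (inv\<^bsub>G\<^esub> x, x)"
      have "?lhs = c \<otimes>\<^bsub>K\<^esub> \<beta> x (y \<otimes>\<^bsub>G\<^esub> z)"
        using xyz by (simp add: c_def \<mu> K.m_ac)
      moreover have "?rhs = c \<otimes>\<^bsub>K\<^esub> (\<beta> x y \<otimes>\<^bsub>K\<^esub> \<beta> x z)"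
        unfolding c_def normalised_cocycle_compat[OF \<alpha> one xyz]
        using xyz by (simp add: \<mu> K.m_ac)
      moreover have "c \<in> carrier K"
        using xyz by (simp add: c_def)
      ultimately show ?thesis
        using xyz by simp
    qed
    have cocycle: "\<mu> (y, z) \<otimes>\<^bsub>K\<^esub> \<mu> (x, y \<otimes>\<^bsub>G\<^esub> z) = \<mu> (x \<otimes>\<^bsub>G\<^esub> y, z) \<otimes>\<^bsub>K\<^esub> \<mu> (x, y)
        \<longleftrightarrow> \<beta> y z \<otimes>\<^bsub>K\<^esub> \<beta> x (y \<otimes>\<^bsub>G\<^esub> z) = \<beta> (x \<otimes>\<^bsub>G\<^esub> y) z \<otimes>\<^bsub>K\<^esub> \<beta> x y"
      if xyz: "x \<in> carrier G" "y \<in> carrier G" "z \<in> carrier G" for x y z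
    proof -
      \<comment> \<open>Here the cocycle identity of \<alpha> supplies the common factor that
        cancels.\<close>
      have "\<mu> (y, z) \<otimes>\<^bsub>K\<^esub> \<mu> (x, y \<otimes>\<^bsub>G\<^esub> z) =
          (\<alpha> (x \<otimes>\<^bsub>G\<^esub> y, z) \<otimes>\<^bsub>K\<^esub> \<alpha> (x, y)) \<otimes>\<^bsub>K\<^esub> (\<beta> y z \<otimes>\<^bsub>K\<^esub> \<beta> x (y \<otimes>\<^bsub>G\<^esub> z))"
        unfolding cocycle_eq[OF \<alpha> xyz, symmetric] using xyz by (simp add: \<mu> K.m_ac)
      moreover have "\<mu> (x \<otimes>\<^bsub>G\<^esub> y, z) \<otimes>\<^bsub>K\<^esub> \<mu> (x, y) =
          (\<alpha> (x \<otimes>\<^bsub>G\<^esub> y, z) \<otimes>\<^bsub>K\<^esub> \<alpha> (x, y)) \<otimes>\<^bsub>K\<^esub> (\<beta> (x \<otimes>\<^bsub>G\<^esub> y) z \<otimes>\<^bsub>K\<^esub> \<beta> x y)"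
        using xyz by (simp add: \<mu> K.m_ac)
      ultimately show ?thesis
        using xyz by simp
    qed
    \<comment> \<open>Expanding \<open>\<beta> x (y \<otimes> z)\<close> produces the factor
      \<open>\<beta> x y\<close> on both sides; cancelling it turns the cocycle condition into
      multiplicativity in the first argument.\<close>
    have left: "\<beta> y z \<otimes>\<^bsub>K\<^esub> \<beta> x (y \<otimes>\<^bsub>G\<^esub> z) = \<beta> (x \<otimes>\<^bsub>G\<^esub> y) z \<otimes>\<^bsub>K\<^esub> \<beta> x y
        \<longleftrightarrow> \<beta> (x \<otimes>\<^bsub>G\<^esub> y) z = \<beta> x z \<otimes>\<^bsub>K\<^esub> \<beta> y z"
      if xyz: "x \<in> carrier G" "y \<in> carrier G" "z \<in> carrier G"
        and "\<beta> x (y \<otimes>\<^bsub>G\<^esub> z) = \<beta> x y \<otimes>\<^bsub>K\<^esub> \<beta> x z" for x y z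
    proof -
      have "\<beta> y z \<otimes>\<^bsub>K\<^esub> \<beta> x (y \<otimes>\<^bsub>G\<^esub> z) = (\<beta> x z \<otimes>\<^bsub>K\<^esub> \<beta> y z) \<otimes>\<^bsub>K\<^esub> \<beta> x y"
        using that by (simp add: K.m_ac)
      then show ?thesis using xyz by auto
    qed
    have R: "?R \<longleftrightarrow> (\<forall>x\<in>carrier G. \<forall>y\<in>carrier G. \<forall>z\<in>carrier G.
      \<beta> (x \<otimes>\<^bsub>G\<^esub> y) z = \<beta> x z \<otimes>\<^bsub>K\<^esub> \<beta> y z \<and> \<beta> x (y \<otimes>\<^bsub>G\<^esub> z) = \<beta> x y \<otimes>\<^bsub>K\<^esub> \<beta> x z)"
      using \<alpha> one ratio_carrier[of \<alpha> \<mu>] unfolding Hom_Hom_iff \<beta>_def by simp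
    show ?thesis
    proof
      assume ?L
      then have \<mu>_cocycle: "\<mu> \<in> cocycles2 G K"
        and right: "\<And>x y z. x \<in> carrier G \<Longrightarrow> y \<in> carrier G \<Longrightarrow> z \<in> carrier G \<Longrightarrow>
          \<beta> x (y \<otimes>\<^bsub>G\<^esub> z) = \<beta> x y \<otimes>\<^bsub>K\<^esub> \<beta> x z"
        by (auto simp: factor_sets_def compat)
      have "\<beta> (x \<otimes>\<^bsub>G\<^esub> y) z = \<beta> x z \<otimes>\<^bsub>K\<^esub> \<beta> y z"
        if xyz: "x \<in> carrier G" "y \<in> carrier G" "z \<in> carrier G" for x y z
        using left[OF xyz right[OF xyz]] cocycle[OF xyz] cocycle_eq[OF \<mu>_cocycle xyz] by blast
      with right show ?R
        unfolding R by blast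
    next
      assume ?R
      then have bilinear: "\<beta> (x \<otimes>\<^bsub>G\<^esub> y) z = \<beta> x z \<otimes>\<^bsub>K\<^esub> \<beta> y z"
          "\<beta> x (y \<otimes>\<^bsub>G\<^esub> z) = \<beta> x y \<otimes>\<^bsub>K\<^esub> \<beta> x z"
        if "x \<in> carrier G" "y \<in> carrier G" "z \<in> carrier G" for x y z
        using that unfolding R by blast+
      have "\<mu> (y, z) \<otimes>\<^bsub>K\<^esub> \<mu> (x, y \<otimes>\<^bsub>G\<^esub> z) = \<mu> (x \<otimes>\<^bsub>G\<^esub> y, z) \<otimes>\<^bsub>K\<^esub> \<mu> (x, y)"
        if xyz: "x \<in> carrier G" "y \<in> carrier G" "z \<in> carrier G" for x y z
        using left[OF xyz bilinear(2)[OF xyz]] cocycle[OF xyz] bilinear(1)[OF xyz] by blast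
      then have \<mu>_cocycle: "\<mu> \<in> cocycles2 G K"
        unfolding cocycles2_iff by simp
      \<comment> \<open>The value \<open>\<beta> 1 1\<close> equals its own square, hence is
        trivial.\<close>
      have \<mu>_one: "\<mu> (\<one>\<^bsub>G\<^esub>, \<one>\<^bsub>G\<^esub>) = \<one>\<^bsub>K\<^esub>"
        using bilinear(1)[of "\<one>\<^bsub>G\<^esub>" "\<one>\<^bsub>G\<^esub>" "\<one>\<^bsub>G\<^esub>"] one by (simp add: \<mu>)
      have "\<alpha> (\<one>\<^bsub>G\<^esub>, x) = \<one>\<^bsub>K\<^esub> \<and> \<alpha> (x, \<one>\<^bsub>G\<^esub>) = \<one>\<^bsub>K\<^esub> \<and>
          \<mu> (\<one>\<^bsub>G\<^esub>, x) = \<one>\<^bsub>K\<^esub> \<and> \<mu> (x, \<one>\<^bsub>G\<^esub>) = \<one>\<^bsub>K\<^esub>" if "x \<in> carrier G" for x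
        using cocycle_one[OF \<alpha> that] cocycle_one[OF \<mu>_cocycle that] one \<mu>_one by auto
      then show ?L
        using \<alpha> \<mu>_cocycle compat bilinear(2) by (simp add: factor_sets_def)
    qed
  qed
qed

section \<open>Multiplicativity of the ratio and the group of factor sets\<close>

sublocale HH: comm_group "Hom_group G (Hom_group G K)"
  by (intro G.comm_group_Hom_group K.comm_group_axioms)

lemma Hom_Hom_mult [simp]:
  "x \<in> carrier G \<Longrightarrow> y \<in> carrier G \<Longrightarrow>
    (b \<otimes>\<^bsub>Hom_group G (Hom_group G K)\<^esub> b') x y = b x y \<otimes>\<^bsub>K\<^esub> b' x y"
  by (simp add: Hom_group_def)

lemma Hom_Hom_one [simp]:
  "x \<in> carrier G \<Longrightarrow> y \<in> carrier G \<Longrightarrow> \<one>\<^bsub>Hom_group G (Hom_group G K)\<^esub> x y = \<one>\<^bsub>K\<^esub>"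
  by (simp add: Hom_group_def)

lemma bivariate_ext:
  assumes "b \<in> (carrier G \<rightarrow>\<^sub>E (carrier G \<rightarrow>\<^sub>E carrier K))" "b' \<in> (carrier G \<rightarrow>\<^sub>E (carrier G \<rightarrow>\<^sub>E carrier K))"
    and "\<And>x y. x \<in> carrier G \<Longrightarrow> y \<in> carrier G \<Longrightarrow> b x y = b' x y"
  shows "b = b'"
  by (rule PiE_ext[OF assms(1,2)], rule PiE_ext[of _ "carrier G" "\<lambda>_. carrier K"])
     (use assms in auto)

text \<open>The product of \<open>Hom_group\<close> is a pointwise formula that makes sense outside
  its carrier as well. The equation therefore holds for arbitrary cochains and can serve to prove
  that factor sets are closed under products.\<close>

lemma ratio_mult:
  assumes "\<alpha> \<in> carrier (cochains2 G K)" "\<mu> \<in> carrier (cochains2 G K)"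
    "\<alpha>' \<in> carrier (cochains2 G K)" "\<mu>' \<in> carrier (cochains2 G K)"
  shows "ratio (\<alpha> \<otimes>\<^bsub>cochains2 G K\<^esub> \<alpha>', \<mu> \<otimes>\<^bsub>cochains2 G K\<^esub> \<mu>') =
    ratio (\<alpha>, \<mu>) \<otimes>\<^bsub>Hom_group G (Hom_group G K)\<^esub> ratio (\<alpha>', \<mu>')"
proof (rule bivariate_ext)
  show "ratio (\<alpha>, \<mu>) \<otimes>\<^bsub>Hom_group G (Hom_group G K)\<^esub> ratio (\<alpha>', \<mu>')
      \<in> carrier G \<rightarrow>\<^sub>E (carrier G \<rightarrow>\<^sub>E carrier K)"
    using assms by (auto simp: Hom_group_def)
qed (use assms in \<open>auto simp: ratio_carrier K.inv_mult K.m_ac\<close>)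

lemma ratio_inv:
  assumes "\<alpha> \<in> carrier (cochains2 G K)" "\<mu> \<in> carrier (cochains2 G K)"
    and hom: "ratio (\<alpha>, \<mu>) \<in> carrier (Hom_group G (Hom_group G K))"
  shows "ratio (inv\<^bsub>cochains2 G K\<^esub> \<alpha>, inv\<^bsub>cochains2 G K\<^esub> \<mu>) \<in> carrier (Hom_group G (Hom_group G K))"
proof -
  have "ratio (inv\<^bsub>cochains2 G K\<^esub> \<alpha>, inv\<^bsub>cochains2 G K\<^esub> \<mu>) x y = inv\<^bsub>K\<^esub> (ratio (\<alpha>, \<mu>) x y)"
    if "x \<in> carrier G" "y \<in> carrier G" for x y
    using that assms(1,2) by (simp add: K.inv_mult)
  moreover have "ratio (\<alpha>, \<mu>) x y \<in> carrier K" if "x \<in> carrier G" "y \<in> carrier G" for x y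
    using that assms(1,2) by simp
  ultimately show ?thesis
    using hom assms(1,2) unfolding Hom_Hom_iff
    by (auto simp: ratio_carrier K.inv_mult simp del: ratio_apply)
qed

text \<open>By \<open>factor_sets_iff\<close>, closure reduces to closure of the cocycles, of the
  condition at (1, 1) and of the bimultiplicative maps.\<close>

lemma subgroup_factor_sets: "subgroup (factor_sets Q K) (cochains2 G K \<times>\<times> cochains2 G K)"
proof (rule group.subgroupI)
  show "group (cochains2 G K \<times>\<times> cochains2 G K)"
    by (intro DirProd_group C.group_axioms)
  show "factor_sets Q K \<subseteq> carrier (cochains2 G K \<times>\<times> cochains2 G K)"
    by (auto simp: factor_sets_iff cocycle_closed)
  have "(\<one>\<^bsub>cochains2 G K\<^esub>, \<one>\<^bsub>cochains2 G K\<^esub>) \<in> factor_sets Q K"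
    by (simp add: factor_sets_iff Hom_Hom_iff ratio_carrier cocycles2_iff)
  then show "factor_sets Q K \<noteq> {}" by blast
next
  fix p assume "p \<in> factor_sets Q K"
  then show "inv\<^bsub>cochains2 G K \<times>\<times> cochains2 G K\<^esub> p \<in> factor_sets Q K"
    using subgroup.m_inv_closed[OF subgroup_cocycles2]
    by (cases p) (auto simp: factor_sets_iff cocycle_closed ratio_inv)
next
  fix p q assume "p \<in> factor_sets Q K" "q \<in> factor_sets Q K"
  then show "p \<otimes>\<^bsub>cochains2 G K \<times>\<times> cochains2 G K\<^esub> q \<in> factor_sets Q K"
    using subgroup.m_closed[OF subgroup_cocycles2]
    by (cases p; cases q) (auto simp: factor_sets_iff cocycle_closed ratio_mult)
qed

lemma Z2_b_simps [simp]:
  "carrier (Z2_b Q K) = factor_sets Q K"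
  "(\<alpha>, \<mu>) \<otimes>\<^bsub>Z2_b Q K\<^esub> (\<alpha>', \<mu>') = (\<alpha> \<otimes>\<^bsub>cochains2 G K\<^esub> \<alpha>', \<mu> \<otimes>\<^bsub>cochains2 G K\<^esub> \<mu>')"
  by (simp_all add: Z2_b_def)

lemma group_Z2_b: "group (Z2_b Q K)"
  using group.subgroup_imp_group[OF DirProd_group[OF C.group_axioms C.group_axioms] subgroup_factor_sets]
  by (simp add: Z2_b_def)

section \<open>The homomorphism inducing the isomorphism\<close>

text \<open>Only the first component is taken modulo coboundaries. The two components of an element
  of \<open>B2_b\<close> coincide over a trivial skew brace, so multiplying a factor set by it
  leaves the ratio unchanged.\<close>

definition splitting where
  "splitting p = (B2 #>\<^bsub>Z2\<^esub> fst p, ratio p)"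

lemma group_hom_splitting:
  "group_hom (Z2_b Q K) (H2 G K \<times>\<times> Hom_group G (Hom_group G K)) splitting"
proof (intro group_hom.intro group_hom_axioms.intro homI)
  show "group (Z2_b Q K)" by (rule group_Z2_b)
  show "group (H2 G K \<times>\<times> Hom_group G (Hom_group G K))"
    unfolding H2_def by (intro DirProd_group B.factorgroup_is_group HH.group_axioms)
next
  fix p assume "p \<in> carrier (Z2_b Q K)"
  then show "splitting p \<in> carrier (H2 G K \<times>\<times> Hom_group G (Hom_group G K))"
    by (cases p) (auto simp: splitting_def factor_sets_iff H2_def carrier_FactGroup)
next
  fix p q assume pq: "p \<in> carrier (Z2_b Q K)" "q \<in> carrier (Z2_b Q K)"
  obtain \<alpha> \<mu> \<alpha>' \<mu>' where [simp]: "p = (\<alpha>, \<mu>)" "q = (\<alpha>', \<mu>')" by fastforce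
  have "(B2 #>\<^bsub>Z2\<^esub> \<alpha>) <#>\<^bsub>Z2\<^esub> (B2 #>\<^bsub>Z2\<^esub> \<alpha>') = B2 #>\<^bsub>Z2\<^esub> (\<alpha> \<otimes>\<^bsub>cochains2 G K\<^esub> \<alpha>')"
    using pq B.rcos_sum[of \<alpha> \<alpha>'] by (simp add: factor_sets_iff)
  then show "splitting (p \<otimes>\<^bsub>Z2_b Q K\<^esub> q) =
      splitting p \<otimes>\<^bsub>H2 G K \<times>\<times> Hom_group G (Hom_group G K)\<^esub> splitting q"
    using pq by (simp add: splitting_def factor_sets_iff cocycle_closed ratio_mult H2_def)
qed

lemma splitting_surj:
  "splitting ` carrier (Z2_b Q K) = carrier (H2 G K \<times>\<times> Hom_group G (Hom_group G K))"
proof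
  show "splitting ` carrier (Z2_b Q K) \<subseteq> carrier (H2 G K \<times>\<times> Hom_group G (Hom_group G K))"
    using group_hom.hom_closed[OF group_hom_splitting] by blast
  show "carrier (H2 G K \<times>\<times> Hom_group G (Hom_group G K)) \<subseteq> splitting ` carrier (Z2_b Q K)"
  proof
    fix u assume "u \<in> carrier (H2 G K \<times>\<times> Hom_group G (Hom_group G K))"
    then obtain a b where u: "u = (B2 #>\<^bsub>Z2\<^esub> a, b)" and a: "a \<in> cocycles2 G K"
      and b: "b \<in> carrier (Hom_group G (Hom_group G K))"
      by (auto simp: H2_def carrier_FactGroup)
    note [simp] = cocycle_closed[OF a]
    \<comment> \<open>The coboundary of the constant function \<open>c\<close> is constantly c c^-1
      c = c, so multiplying \<open>a\<close> by it makes the value at (1, 1) trivial without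
      changing the class.\<close>
    define c where "c = inv\<^bsub>K\<^esub> (a (\<one>\<^bsub>G\<^esub>, \<one>\<^bsub>G\<^esub>))"
    have [simp]: "c \<in> carrier K" by (simp add: c_def)
    let ?h = "\<lambda>x\<in>carrier G. c"
    define \<alpha> where "\<alpha> = coboundary1 G K ?h \<otimes>\<^bsub>cochains2 G K\<^esub> a"
    have h: "coboundary1 G K ?h \<in> B2" by auto
    have \<alpha>: "\<alpha> \<in> cocycles2 G K"
      unfolding \<alpha>_def
      by (rule subgroup.m_closed[OF subgroup_cocycles2 coboundary1_cocycle a]) simp
    have one: "\<alpha> (\<one>\<^bsub>G\<^esub>, \<one>\<^bsub>G\<^esub>) = \<one>\<^bsub>K\<^esub>"
      by (simp add: \<alpha>_def) (simp add: c_def)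
    have coset: "B2 #>\<^bsub>Z2\<^esub> \<alpha> = B2 #>\<^bsub>Z2\<^esub> a"
    proof -
      have "\<alpha> \<in> B2 #>\<^bsub>Z2\<^esub> a"
        using Z.rcosI[of "coboundary1 G K ?h" B2 a] h a B.subset by (simp add: \<alpha>_def)
      then show ?thesis
        using Z.repr_independence[of \<alpha> B2 a] a subgroup_coboundaries2 by simp
    qed
    \<comment> \<open>This choice is forced by the requirement that the ratio be
      \<open>b\<close>.\<close>
    define \<mu> where "\<mu> = (\<lambda>(x, y)\<in>carrier G \<times> carrier G. \<alpha> (x, y) \<otimes>\<^bsub>K\<^esub> b x y)"
    note [simp] = cocycle_closed[OF \<alpha>]
    have bc [simp]: "b x y \<in> carrier K" if "x \<in> carrier G" "y \<in> carrier G" for x y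
      using b that by (auto simp: Hom_Hom_iff PiE_iff)
    have \<mu>: "\<mu> \<in> carrier (cochains2 G K)"
      unfolding carrier_cochains2 by (auto simp: \<mu>_def)
    have "ratio (\<alpha>, \<mu>) = b"
    proof (rule bivariate_ext)
      fix x y assume xy: "x \<in> carrier G" "y \<in> carrier G"
      have "ratio (\<alpha>, \<mu>) x y = (\<alpha> (x, y) \<otimes>\<^bsub>K\<^esub> inv\<^bsub>K\<^esub> (\<alpha> (x, y))) \<otimes>\<^bsub>K\<^esub> b x y"
        using xy by (simp add: \<mu>_def K.m_ac del: K.r_inv K.Units_r_inv)
      then show "ratio (\<alpha>, \<mu>) x y = b x y"
        using xy by simp
    qed (use \<mu> b in \<open>auto simp: ratio_carrier Hom_Hom_iff\<close>)
    then have "(\<alpha>, \<mu>) \<in> carrier (Z2_b Q K)" "splitting (\<alpha>, \<mu>) = u"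
      using \<alpha> one \<mu> b coset by (simp_all add: factor_sets_iff splitting_def u)
    then show "u \<in> splitting ` carrier (Z2_b Q K)" by blast
  qed
qed

lemma kernel_splitting:
  "kernel (Z2_b Q K) (H2 G K \<times>\<times> Hom_group G (Hom_group G K)) splitting = B2_b Q K"
proof -
  have "(\<alpha>, \<mu>) \<in> kernel (Z2_b Q K) (H2 G K \<times>\<times> Hom_group G (Hom_group G K)) splitting \<longleftrightarrow>
    (\<alpha>, \<mu>) \<in> B2_b Q K" for \<alpha> \<mu>
  proof
    assume "(\<alpha>, \<mu>) \<in> kernel (Z2_b Q K) (H2 G K \<times>\<times> Hom_group G (Hom_group G K)) splitting"
    then have fs: "\<alpha> \<in> cocycles2 G K" "\<alpha> (\<one>\<^bsub>G\<^esub>, \<one>\<^bsub>G\<^esub>) = \<one>\<^bsub>K\<^esub>" "\<mu> \<in> carrier (cochains2 G K)"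
      and coset: "B2 #>\<^bsub>Z2\<^esub> \<alpha> = B2"
      and ratio: "ratio (\<alpha>, \<mu>) = \<one>\<^bsub>Hom_group G (Hom_group G K)\<^esub>"
      by (auto simp: kernel_def factor_sets_iff splitting_def H2_def)
    note [simp] = cocycle_closed[OF fs(1)] fs(3)
    from Z.coset_join1[OF coset _ subgroup_coboundaries2] fs(1)
    obtain h where h: "h \<in> carrier G \<rightarrow>\<^sub>E carrier K" "\<alpha> = coboundary1 G K h"
      by auto
    \<comment> \<open>The coboundary of \<open>h\<close> at (1, 1) is h(1) h(1)^-1 h(1) = h(1). So
      normalisation of \<alpha> passes to \<open>h\<close>, which reconciles the arbitrary functions
      in \<open>B2\<close> with the normalised ones in \<open>B2_b\<close>.\<close>
    have "h \<one>\<^bsub>G\<^esub> \<in> carrier K" using h(1) by auto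
    then have "h \<one>\<^bsub>G\<^esub> = \<one>\<^bsub>K\<^esub>"
      using fs(2) h(2) by simp
    moreover have "\<mu> = \<alpha>"
    proof (rule cochain_eqI)
      fix x y assume xy: "x \<in> carrier G" "y \<in> carrier G"
      then have "\<mu> (x, y) \<otimes>\<^bsub>K\<^esub> inv\<^bsub>K\<^esub> (\<alpha> (x, y)) = \<one>\<^bsub>K\<^esub>"
        using ratio_apply[OF xy, of \<alpha> \<mu>] ratio by simp
      then show "\<mu> (x, y) = \<alpha> (x, y)"
        using xy K.inv_equality[of "\<mu> (x, y)" "inv\<^bsub>K\<^esub> (\<alpha> (x, y))"] by simp
    qed simp_all
    ultimately show "(\<alpha>, \<mu>) \<in> B2_b Q K"
      using h by (auto simp: B2_b_def)
  next
    assume "(\<alpha>, \<mu>) \<in> B2_b Q K"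
    then obtain h where h: "h \<in> carrier G \<rightarrow>\<^sub>E carrier K" "h \<one>\<^bsub>G\<^esub> = \<one>\<^bsub>K\<^esub>"
      and [simp]: "\<alpha> = coboundary1 G K h" "\<mu> = coboundary1 G K h"
      by (auto simp: B2_b_def)
    note [simp] = coboundary1_cochain[OF h(1)]
    have "ratio (\<alpha>, \<mu>) = \<one>\<^bsub>Hom_group G (Hom_group G K)\<^esub>"
    proof (rule bivariate_ext)
      fix x y assume xy: "x \<in> carrier G" "y \<in> carrier G"
      \<comment> \<open>The value of the coboundary is treated as a single element of
        \<open>K\<close>, left unexpanded, so that it cancels against its own inverse.\<close>
      then have "\<alpha> (x, y) \<in> carrier K"
        by (intro cochain_closed) simp_all
      with xy show "ratio (\<alpha>, \<mu>) x y = \<one>\<^bsub>Hom_group G (Hom_group G K)\<^esub> x y"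
        by (simp del: coboundary1_apply)
    next
      show "\<one>\<^bsub>Hom_group G (Hom_group G K)\<^esub> \<in> carrier G \<rightarrow>\<^sub>E (carrier G \<rightarrow>\<^sub>E carrier K)"
        using HH.one_closed unfolding Hom_Hom_iff by blast
    qed (simp add: ratio_carrier)
    moreover have "B2 #>\<^bsub>Z2\<^esub> \<alpha> = B2"
      using h coboundary1_cocycle[OF h(1)]
      by (intro Z.coset_join2 subgroup_coboundaries2) auto
    moreover have "\<alpha> \<in> cocycles2 G K"
      using coboundary1_cocycle[OF h(1)] by simp
    ultimately show "(\<alpha>, \<mu>) \<in> kernel (Z2_b Q K) (H2 G K \<times>\<times> Hom_group G (Hom_group G K)) splitting"
      using h(2) HH.one_closed by (simp add: kernel_def factor_sets_iff splitting_def H2_def)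
  qed
  then show ?thesis by auto
qed

end

theorem theorem1p36:
  fixes G :: "('a, 'm) monoid_scheme" and K :: "('b, 'n) monoid_scheme"
  assumes "group G" and "comm_group K"
  shows "H2_b (trivial_skew_brace G) K \<cong> H2 G K \<times>\<times> Hom_group G (Hom_group G K)"
proof -
  interpret trivial_coefficients G K
    using assms by (simp add: trivial_coefficients_def)
  show ?thesis
    \<comment> \<open>First isomorphism theorem, with the kernel rewritten as
      \<open>B2_b\<close>.\<close>
    using group_hom.FactGroup_iso[OF group_hom_splitting splitting_surj]
    unfolding kernel_splitting H2_b_def .
qed

end
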